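(* Let $\pi$ be a DI-sortable permutation of $[n]$ and let $W$ be a DI word of $\pi$. Then $W$ is the ADI word of $\pi$ if and only if $\mathsf{E}_1$, $\mathsf{N}_1$, $\mathsf{C}_1$ appear consecutively (in this order) in $W$, and for each $i\in[n]$ with $\pi_i\neq 1$, either $\mathsf{C}_{\pi_i-1}$ appears immediately before $\mathsf{C}_{\pi_i}$, or $\mathsf{E}_{\pi_i}$, $\mathsf{N}_{\pi_i}$, $\mathsf{C}_{\pi_i}$ appear consecutively (in this order) in $W$. Equivalently, a DI word of $\pi$ is its ADI word if and only if every maximal block of consecutive letters $\mathsf{C}$ in $W$ is immediately preceded by $\mathsf{E}\mathsf{N}$.
   Context: A permutation $\pi=\pi_1\cdots\pi_n$ of $[n]$ is processed by a machine consisting of an input (initially $\pi_1,\dots,\pi_n$, read left to right), a first stack, a second stack, and an output, with operations: $\mathsf{E}$ moves the next input entry onto the top of the first stack; $\mathsf{N}$ pops the top of the first stack and pushes it onto the second stack; $\mathsf{C}$ pops the top of the second stack to the output. A sorting word of $\pi$ is a word over $\{\mathsf{E},\mathsf{N},\mathsf{C}\}$ whose operations are all legal when applied in order starting from $\pi$ in the input and empty stacks, and whose final output is $12\cdots n$. A DI word is a sorting word during which the first stack's entries always decrease from top to bottom and the second stack's entries always increase from top to bottom; $\pi$ is DI-sortable if it has a DI word. In a sorting word, the unique occurrences of $\mathsf{E},\mathsf{N},\mathsf{C}$ moving value $j$ are denoted $\mathsf{E}_j,\mathsf{N}_j,\mathsf{C}_j$. The ADI word of a DI-sortable $\pi$ is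 the word of operations performed by the following algorithm, which at each stage performs the first applicable step: (1) if the top entry of the second stack is the smallest value not yet output, perform $\mathsf{C}$; (2) if the first stack is nonempty and its $m$ entries are exactly the next $m$ values to be output, transfer all of them to the second stack by $m$ successive $\mathsf{N}$ operations; (3) otherwise, if the next input entry is smaller than the top of the second stack and larger than the top of the first stack (each comparison counting as satisfied if the corresponding stack is empty), perform $\mathsf{E}$; (4) otherwise perform $\mathsf{N}$. It is known that for every DI-sortable permutation this algorithm produces a DI word of it. *)

theory Defs
  imports "HOL-Combinatorics.Multiset_Permutations" "HOL-Library.Sublist"
begin

datatype move = E | N | C

text \<open>
  A configuration is (input, first stack, second stack, output). The head of a stack is its top,
  the head of the input is the next entry to be read, and the output is listed in the order
  in which its entries were produced.
\<close>

type_synonym config = "nat list \<times> nat list \<times> nat list \<times> nat list"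

definition initial :: "nat list \<Rightarrow> config" where
  "initial \<pi> = (\<pi>, [], [], [])"

text \<open>The result is \<^const>\<open>None\<close> exactly if the operation is illegal.\<close>

fun exec :: "move \<Rightarrow> config \<Rightarrow> config option" where
  "exec E (x # inp, s, t, out) = Some (inp, x # s, t, out)"
| "exec N (inp, x # s, t, out) = Some (inp, s, x # t, out)"
| "exec C (inp, s, x # t, out) = Some (inp, s, t, out @ [x])"
| "exec _ _ = None"

fun run :: "move list \<Rightarrow> config \<Rightarrow> config option" where
  "run [] c = Some c"
| "run (m # w) c = Option.bind (exec m c) (run w)"

definition sorting_word :: "nat list \<Rightarrow> move list \<Rightarrow> bool" where
  "sorting_word \<pi> W \<longleftrightarrow>
     (\<exists>inp s t. run W (initial \<pi>) = Some (inp, s, t, [1..<Suc (length \<pi>)]))"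

definition DI_word :: "nat list \<Rightarrow> move list \<Rightarrow> bool" where
  "DI_word \<pi> W \<longleftrightarrow> sorting_word \<pi> W \<and>
     (\<forall>k\<le>length W. \<forall>inp s t out. run (take k W) (initial \<pi>) = Some (inp, s, t, out) \<longrightarrow>
        sorted_wrt (>) s \<and> sorted_wrt (<) t)"

definition DI_sortable :: "nat list \<Rightarrow> bool" where
  "DI_sortable \<pi> \<longleftrightarrow> (\<exists>W. DI_word \<pi> W)"

fun moved_value :: "move \<Rightarrow> config \<Rightarrow> nat" where
  "moved_value E (inp, s, t, out) = hd inp"
| "moved_value N (inp, s, t, out) = hd s"
| "moved_value C (inp, s, t, out) = hd t"

fun label_from :: "move list \<Rightarrow> config \<Rightarrow> (move \<times> nat) list" where
  "label_from [] c = []"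
| "label_from (m # w) c =
     (case exec m c of None \<Rightarrow> [] | Some c' \<Rightarrow> (m, moved_value m c) # label_from w c')"

text \<open>
  Each letter is paired with the value it moves, so that the occurrence of \<^const>\<open>E\<close> moving \<open>j\<close>
  is the entry \<^term>\<open>(E, j)\<close>.
\<close>

definition labelled_word :: "nat list \<Rightarrow> move list \<Rightarrow> (move \<times> nat) list" where
  "labelled_word \<pi> W = label_from W (initial \<pi>)"

definition next_output :: "nat list \<Rightarrow> nat" where
  "next_output out = (LEAST v. 1 \<le> v \<and> v \<notin> set out)"

text \<open>
  The operations performed by one step of the ADI algorithm. In the second case, the output
  produced by the algorithm so far is an initial segment of the positive integers, so that the
  next \<open>m\<close> values to be output are consecutive integers starting with the next one.
\<close>

fun ADI_step :: "config \<Rightarrow> move list" where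
  "ADI_step (inp, s, t, out) =
     (if t \<noteq> [] \<and> hd t = next_output out then [C]
      else if s \<noteq> [] \<and> set s = {next_output out ..< next_output out + length s}
        then replicate (length s) N
      else if inp \<noteq> [] \<and> (t = [] \<or> hd inp < hd t) \<and> (s = [] \<or> hd s < hd inp) then [E]
      else [N])"

fun pending_moves :: "config \<Rightarrow> nat" where
  "pending_moves (inp, s, t, out) = 3 * length inp + 2 * length s + length t"

lemma exec_pending_moves: "exec m c = Some c' \<Longrightarrow> pending_moves c = Suc (pending_moves c')"
  by (induction m c rule: exec.induct) auto

lemma run_pending_moves: "run w c = Some c' \<Longrightarrow> pending_moves c = length w + pending_moves c'"
  by (induction w arbitrary: c) (auto simp: bind_eq_Some_conv dest!: exec_pending_moves)

lemma ADI_step_nonempty: "ADI_step c \<noteq> []"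
  by (cases c) auto

text \<open>
  The algorithm stops when the prescribed operations are illegal. This happens once everything has
  been output; on a permutation that is not DI-sortable it may also happen earlier.
\<close>

function ADI_from :: "config \<Rightarrow> move list" where
  "ADI_from c =
     (case run (ADI_step c) c of None \<Rightarrow> [] | Some c' \<Rightarrow> ADI_step c @ ADI_from c')"
  by auto
termination
  by (relation "measure pending_moves")
     (auto dest!: run_pending_moves simp: ADI_step_nonempty)

declare ADI_from.simps [simp del]

definition ADI_word :: "nat list \<Rightarrow> move list" where
  "ADI_word \<pi> = ADI_from (initial \<pi>)"

definition maximal_C_block :: "move list \<Rightarrow> move list \<Rightarrow> nat \<Rightarrow> move list \<Rightarrow> bool" where
  "maximal_C_block W u k v \<longleftrightarrow> W = u @ replicate k C @ v \<and> k \<ge> 1 \<and>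
     (u = [] \<or> last u \<noteq> C) \<and> (v = [] \<or> hd v \<noteq> C)"

end

theory Submission
  imports Defs
begin

text \<open>
  Call a word licensed if every letter \<^const>\<open>C\<close> is preceded by \<^const>\<open>C\<close> or by
  \<^const>\<open>E\<close>\<^const>\<open>N\<close>; both conditions of the theorem say that \<open>W\<close> is licensed.

  Let \<open>j\<close> be the next value to be output. In a licensed DI word, \<open>j\<close> can lie on the first stack
  only immediately after its entry, as the only entry there, and \<open>j\<close> is output as soon as it is on
  the second stack. So rules (1) and (2) of the algorithm are obeyed, and only the choice between
  \<^const>\<open>E\<close> and \<^const>\<open>N\<close> when \<open>j\<close> is still in the input remains. A wrong choice leaves a value \<open>z\<close>
  on the second stack while some \<open>x > z > j\<close> is on the first stack or is the next input entry.
  Then \<open>x\<close> must leave the first stack before \<open>j\<close> enters it, but cannot be put on top of \<open>z\<close>, and \<open>z\<close>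
  has to wait for \<open>j\<close>. Conversely, the algorithm maintains that \<open>j\<close> is on the first stack only
  alone and just after an \<^const>\<open>E\<close>, and is on top of the second stack only if the first stack is
  empty and a letter \<^const>\<open>C\<close> is licensed.
\<close>

section \<open>Licensed words and maximal blocks of \<open>C\<close>\<close>

text \<open>The prefix \<open>u\<close> holds the letters already read, so that the condition passes
  to tails of a word, where a \<open>C\<close> may be licensed by letters of
  \<open>u\<close>.\<close>

definition licensed :: "move list \<Rightarrow> move list \<Rightarrow> bool" where
  "licensed u w \<longleftrightarrow>
     (\<forall>p q. w = p @ C # q \<longrightarrow> suffix [C] (u @ p) \<or> suffix [E, N] (u @ p))"

lemma licensed_Nil [simp]: "licensed u []"
  by (simp add: licensed_def)

lemma licensed_Cons:
  "licensed u (m # w) \<longleftrightarrow>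
     (m = C \<longrightarrow> suffix [C] u \<or> suffix [E, N] u) \<and> licensed (u @ [m]) w"
proof -
  have "(\<forall>p q. m # w = p @ C # q \<longrightarrow> P p) \<longleftrightarrow>
      (m = C \<longrightarrow> P []) \<and> (\<forall>p q. w = p @ C # q \<longrightarrow> P (m # p))" for P
    unfolding Cons_eq_append_conv by blast
  then show ?thesis
    by (simp add: licensed_def)
qed

text \<open>Inside a block every \<open>C\<close> but the first is licensed by its predecessor. The
  first one does not follow a \<open>C\<close>, so only \<open>E\<close> \<open>N\<close> can
  license it.\<close>

lemma licensed_iff_maximal_C_block:
  "licensed [] W \<longleftrightarrow> (\<forall>u k v. maximal_C_block W u k v \<longrightarrow> suffix [E, N] u)"
proof (intro iffI allI impI)
  fix u k v
  assume lic: "licensed [] W" and max: "maximal_C_block W u k v"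
  then obtain k' where "W = u @ C # replicate k' C @ v"
    by (cases k) (auto simp: maximal_C_block_def)
  with lic have "suffix [C] u \<or> suffix [E, N] u"
    unfolding licensed_def by fastforce
  with max show "suffix [E, N] u"
    by (auto simp: maximal_C_block_def suffix_def)
next
  assume blocks: "\<forall>u k v. maximal_C_block W u k v \<longrightarrow> suffix [E, N] u"
  have split_Cs: "\<exists>k v. w = replicate k C @ v \<and> (v = [] \<or> hd v \<noteq> C)" for w
  proof (induction w)
    case (Cons m w)
    then obtain k v where kv: "w = replicate k C @ v" "v = [] \<or> hd v \<noteq> C"
      by blast
    show ?case
    proof (cases "m = C")
      case True
      with kv show ?thesis
        by (intro exI[of _ "Suc k"] exI[of _ v]) auto
    next
      case False
      then show ?thesis
        by (intro exI[of _ 0] exI[of _ "m # w"]) auto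
    qed
  qed simp
  show "licensed [] W"
    unfolding licensed_def
  proof (intro allI impI)
    fix p q
    assume W: "W = p @ C # q"
    obtain k v where q: "q = replicate k C @ v" "v = [] \<or> hd v \<noteq> C"
      using split_Cs by blast
    show "suffix [C] ([] @ p) \<or> suffix [E, N] ([] @ p)"
    proof (cases "p \<noteq> [] \<and> last p = C")
      case True
      then show ?thesis
        by (metis append_Nil append_butlast_last_id suffix_def)
    next
      case False
      with W q have "maximal_C_block W p (Suc k) v"
        by (auto simp: maximal_C_block_def)
      with blocks have "suffix [E, N] p"
        by blast
      then show ?thesis
        by simp
    qed
  qed
qed

section \<open>Successful DI runs and their invariants\<close>

text \<open>Fixing the final configuration lets invariants be proved by induction on the remaining
  word, that is, backwards from the end of the run.\<close>

fun DI_completes :: "nat \<Rightarrow> move list \<Rightarrow> config \<Rightarrow> bool" where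
  "DI_completes n [] c \<longleftrightarrow> c = ([], [], [], [1..<Suc n])"
| "DI_completes n (m # w) (inp, s, t, out) \<longleftrightarrow> sorted_wrt (>) s \<and> sorted_wrt (<) t \<and>
     (\<exists>c'. exec m (inp, s, t, out) = Some c' \<and> DI_completes n w c')"

lemma exec_E_iff [simp]:
  "exec E (inp, s, t, out) = Some c' \<longleftrightarrow> (\<exists>x inp'. inp = x # inp' \<and> c' = (inp', x # s, t, out))"
  by (cases inp) auto

lemma exec_N_iff [simp]:
  "exec N (inp, s, t, out) = Some c' \<longleftrightarrow> (\<exists>x s'. s = x # s' \<and> c' = (inp, s', x # t, out))"
  by (cases s) auto

lemma exec_C_iff [simp]:
  "exec C (inp, s, t, out) = Some c' \<longleftrightarrow> (\<exists>x t'. t = x # t' \<and> c' = (inp, s, t', out @ [x]))"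
  by (cases t) auto

lemma DI_completes_E [simp]:
  "DI_completes n (E # w) (inp, s, t, out) \<longleftrightarrow> sorted_wrt (>) s \<and> sorted_wrt (<) t \<and>
     (\<exists>x inp'. inp = x # inp' \<and> DI_completes n w (inp', x # s, t, out))"
  by auto

lemma DI_completes_N [simp]:
  "DI_completes n (N # w) (inp, s, t, out) \<longleftrightarrow> sorted_wrt (>) s \<and> sorted_wrt (<) t \<and>
     (\<exists>x s'. s = x # s' \<and> DI_completes n w (inp, s', x # t, out))"
  by auto

lemma upt_eq_snoc:
  assumes "[1..<k] = out @ [x]"
  shows "x = Suc (length out)" "[1..<Suc (length out)] = out"
proof -
  have "k = Suc (Suc (length out))"
    using arg_cong[OF assms, of length] by simp
  with assms have "out @ [x] = [1..<Suc (length out)] @ [Suc (length out)]"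
    by (metis le_add1 plus_1_eq_Suc upt_Suc_append)
  then show "x = Suc (length out)" "[1..<Suc (length out)] = out"
    by (simp_all del: upt_Suc)
qed

text \<open>Outputs are only extended at their end, so each one is a prefix of the final
  \<open>[1..<Suc n]\<close>.\<close>

lemma DI_completes_output:
  assumes "DI_completes n w (inp, s, t, out)"
  shows "[1..<Suc (length out)] = out"
  using assms
proof (induction w arbitrary: inp s t out)
  case Nil
  then show ?case by (auto simp del: upt_Suc)
next
  case (Cons m w)
  then show ?case
    by (cases m) (auto simp del: upt_Suc dest!: Cons.IH upt_eq_snoc(2))
qed

lemma DI_completes_invariant:
  assumes "DI_completes n w (inp, s, t, out)"
  shows "length out \<le> n \<and> distinct (inp @ s @ t) \<and>
    set inp \<union> set s \<union> set t = {Suc (length out)..n} \<and> sorted_wrt (>) s \<and> sorted_wrt (<) t"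
  using assms
proof (induction w arbitrary: inp s t out)
  case (Cons m w)
  show ?case
  proof (cases m)
    case E
    with Cons.prems obtain x inp' where x: "inp = x # inp'" "DI_completes n w (inp', x # s, t, out)"
      by auto
    from Cons.IH[OF x(2)] x(1) Cons.prems show ?thesis by auto
  next
    case N
    with Cons.prems obtain x s' where x: "s = x # s'" "DI_completes n w (inp, s', x # t, out)"
      by auto
    from Cons.IH[OF x(2)] x(1) Cons.prems show ?thesis by auto
  next
    case C
    with Cons.prems obtain x t' where x: "t = x # t'" "DI_completes n w (inp, s, t', out @ [x])"
      by auto
    note IH = Cons.IH[OF x(2)]
    \<comment> \<open>\<open>out @ [x]\<close> is again an initial segment, which determines
      \<open>x\<close>.\<close>
    have out: "x = Suc (length out)"
      using upt_eq_snoc(1)[OF DI_completes_output[OF x(2)]] .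
    have rest: "set inp \<union> set s \<union> set t' = {Suc (Suc (length out))..n}" and "length out < n"
      using IH by auto
    then have "insert x (set inp \<union> set s \<union> set t') = {Suc (length out)..n}"
      unfolding out rest by (intro atLeastAtMost_insertL) simp
    then have "set inp \<union> set s \<union> set t = {Suc (length out)..n}"
      using x(1) by simp
    moreover have "x \<notin> set inp \<union> set s \<union> set t'"
      unfolding out rest by simp
    then have "x \<notin> set inp" "x \<notin> set s" "x \<notin> set t'"
      by auto
    then have "distinct (inp @ s @ t)"
      using IH x(1) by simp
    ultimately show ?thesis
      using \<open>length out < n\<close> Cons.prems by (simp add: DI_completes.simps(2))
  qed
qed auto

lemma next_output_upt: "next_output [1..<Suc k] = Suc k"
  unfolding next_output_def by (rule Least_equality) auto

lemma DI_completes_next_output: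
  "DI_completes n w (inp, s, t, out) \<Longrightarrow> next_output out = Suc (length out)"
  by (metis DI_completes_output next_output_upt)

lemma DI_completes_C [simp]:
  "DI_completes n (C # w) (inp, s, t, out) \<longleftrightarrow> sorted_wrt (>) s \<and> sorted_wrt (<) t \<and>
     (\<exists>t'. t = Suc (length out) # t' \<and> DI_completes n w (inp, s, t', out @ [Suc (length out)]))"
proof -
  have "x = Suc (length out)" if "DI_completes n w (inp, s, t', out @ [x])" for x t'
    using upt_eq_snoc(1)[OF DI_completes_output[OF that]] .
  then show ?thesis
    unfolding DI_completes.simps(2) exec_C_iff by blast
qed

declare DI_completes.simps(2) [simp del]

section \<open>The next output value in licensed words\<close>

text \<open>As \<open>p\<close> has no \<open>C\<close>, the final \<open>C\<close> outputs
  \<open>Suc (length out)\<close>, which the preceding \<open>N\<close> has just taken from the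
  first stack; tracing it back through \<open>p\<close> leads to the first stack or the
  input.\<close>

lemma next_in_s_or_input:
  assumes "DI_completes n (p @ N # C # q) (inp, s, t, out)" "C \<notin> set p"
  shows "Suc (length out) \<in> set inp \<union> set s"
  using assms
proof (induction p arbitrary: inp s t)
  case Nil
  then show ?case by auto
next
  case (Cons m p)
  then show ?case by (cases m) fastforce+
qed

lemma next_in_input:
  assumes "DI_completes n (p @ E # N # C # q) (inp, s, t, out)" "C \<notin> set p"
  shows "Suc (length out) \<in> set inp"
  using assms
proof (induction p arbitrary: inp s t)
  case Nil
  then show ?case by auto
next
  case (Cons m p)
  then show ?case by (cases m) fastforce+
qed

lemma DI_completes_contains_C:
  assumes "DI_completes n w (inp, s, t, out)" "length out < n"
  shows "C \<in> set w"
  using assms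
proof (induction w arbitrary: inp s t)
  case (Cons m w)
  then show ?case by (cases m) fastforce+
qed auto

text \<open>If the first \<open>C\<close> of \<open>w\<close> is not its first letter, its licence
  must be \<open>E\<close> \<open>N\<close>. Then the value it outputs has just come from the first
  stack and was not on the second one at the start.\<close>

lemma licensed_next_on_second_stack:
  assumes "licensed u w" "DI_completes n w (inp, s, t, out)" "Suc (length out) \<in> set t"
  shows "\<exists>q. w = C # q"
proof -
  note inv = DI_completes_invariant[OF assms(2)]
  from inv assms(3) have "length out < n" by auto
  then obtain p q where w: "w = p @ C # q" "C \<notin> set p"
    using DI_completes_contains_C[OF assms(2)] by (meson split_list_first)
  show ?thesis
  proof (cases p rule: rev_cases)
    case Nil
    with w show ?thesis by simp
  next
    case (snoc p' m)
    with w assms(1) have "m = N"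
      unfolding licensed_def by (fastforce simp: suffix_def)
    with snoc w assms(2) have "Suc (length out) \<in> set inp \<union> set s"
      using next_in_s_or_input[of n p' q] by simp
    with inv assms(3) show ?thesis by auto
  qed
qed

lemma bottom_next_unique:
  assumes "DI_completes n w (inp, Suc (length out) # s, t, out)"
  shows "s = []"
proof (cases s)
  case (Cons a s')
  note inv = DI_completes_invariant[OF assms]
  then have "a \<in> {Suc (length out)..n}"
    unfolding Cons by (metis UnCI list.set_intros)
  moreover have "a < Suc (length out)"
    using inv Cons by simp
  ultimately show ?thesis by auto
qed

text \<open>The first \<open>C\<close> of \<open>w\<close> is not its first letter, so it is
  licensed by \<open>E\<close> \<open>N\<close>. If that \<open>E\<close> lay in \<open>w\<close>,
  the value would still be in the input; hence \<open>w\<close> starts with \<open>N\<close>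
  \<open>C\<close>, and the value is on top, where anything below it would be smaller.\<close>

lemma licensed_next_on_first_stack:
  assumes "licensed u w" "DI_completes n w (inp, s, t, out)" "Suc (length out) \<in> set s"
  shows "\<exists>q. w = N # q \<and> s = [Suc (length out)]"
proof -
  note inv = DI_completes_invariant[OF assms(2)]
  from inv assms(3) have "length out < n" by auto
  then obtain p q where w: "w = p @ C # q" "C \<notin> set p"
    using DI_completes_contains_C[OF assms(2)] by (meson split_list_first)
  show ?thesis
  proof (cases p rule: rev_cases)
    case Nil
    with w inv assms show ?thesis by auto
  next
    case (snoc p' m)
    with w assms(1) have EN: "m = N" "suffix [E, N] (u @ p)"
      unfolding licensed_def by (fastforce simp: suffix_def)+
    show ?thesis
    proof (cases p' rule: rev_cases)
      case Nil
      with snoc w EN have w': "w = N # C # q" by simp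
      with assms(2) obtain s' where "s = Suc (length out) # s'"
        by auto
      with w' assms(2) bottom_next_unique show ?thesis by blast
    next
      case (snoc p'' m')
      with EN \<open>p = p' @ [m]\<close> have "m' = E" by (auto simp: suffix_def)
      with snoc w EN \<open>p = p' @ [m]\<close> assms(2) have "Suc (length out) \<in> set inp"
        using next_in_input[of n p'' q] by simp
      with inv assms(3) show ?thesis by auto
    qed
  qed
qed

section \<open>Licensed words follow the algorithm\<close>

text \<open>The hypotheses survive every letter, but the run must end with empty input. A value read
  by \<open>E\<close> is at least \<open>x\<close>, hence not \<open>i\<close>; a value moved by
  \<open>N\<close> lands above \<open>z\<close>, hence is not \<open>x\<close>; a value output by
  \<open>C\<close> is at most \<open>i\<close>, hence not \<open>z\<close>.\<close>

lemma no_input_behind_blocked: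
  assumes "DI_completes n w (inp, s, t, out)" "z \<in> set t" "z < x" "i < z" "i \<in> set inp"
    and "x \<in> set s \<or> (\<exists>inp'. inp = x # inp')"
  shows False
  using assms
proof (induction w arbitrary: inp s t out)
  case (Cons m w)
  note inv = DI_completes_invariant[OF Cons.prems(1)]
  show ?case
  proof (cases m)
    case E
    with Cons.prems obtain e inp' where e: "inp = e # inp'" "DI_completes n w (inp', e # s, t, out)"
      by auto
    have "x = e \<or> x < e" "x \<in> set (e # s)"
      using DI_completes_invariant[OF e(2)] Cons.prems(6) e(1) by auto
    then show ?thesis
      using Cons.IH[OF e(2) Cons.prems(2-4)] Cons.prems e(1) by auto
  next
    case N
    with Cons.prems obtain y s' where y: "s = y # s'" "DI_completes n w (inp, s', y # t, out)"
      by auto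
    have "y < z"
      using DI_completes_invariant[OF y(2)] Cons.prems(2) by auto
    then show ?thesis
      using Cons.IH[OF y(2) _ Cons.prems(3-5)] Cons.prems y(1) by auto
  next
    case C
    with Cons.prems obtain t' where t: "t = Suc (length out) # t'"
      and t': "DI_completes n w (inp, s, t', out @ [Suc (length out)])"
      by auto
    have "Suc (length out) \<le> i"
      using inv Cons.prems(5) by auto
    then show ?thesis
      using Cons.IH[OF t' _ Cons.prems(3-6)] Cons.prems t by auto
  qed
qed auto

lemma min_at_hd:
  fixes j :: nat
  assumes "sorted_wrt (<) t" "j \<in> set t" "\<forall>x\<in>set t. j \<le> x"
  shows "t \<noteq> [] \<and> hd t = j"
  using assms by (cases t) auto

lemma ADI_step_default:
  assumes "next_output out \<notin> set t" "next_output out \<notin> set s"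
  shows "ADI_step (inp, s, t, out) =
    (if inp \<noteq> [] \<and> (t = [] \<or> hd inp < hd t) \<and> (s = [] \<or> hd s < hd inp) then [E] else [N])"
proof -
  have "\<not> (t \<noteq> [] \<and> hd t = next_output out)"
    using assms(1) by (cases t) auto
  moreover have "\<not> (s \<noteq> [] \<and> set s = {next_output out..<next_output out + length s})"
  proof
    assume "s \<noteq> [] \<and> set s = {next_output out..<next_output out + length s}"
    \<comment> \<open>An interval of positive length contains its left end.\<close>
    then have "next_output out \<in> set s \<longleftrightarrow> 0 < length s" and "0 < length s"
      by simp_all
    with assms(2) show False by simp
  qed
  ultimately show ?thesis
    unfolding ADI_step.simps by (simp only: if_False)
qed

text \<open>The cases are the places where \<open>j\<close> can be. The step is always a single
  letter, because rule (2) only meets a first stack consisting of \<open>j\<close> alone.\<close>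

lemma licensed_first_letter:
  assumes "licensed u (m # w)" "DI_completes n (m # w) c"
  shows "ADI_step c = [m]"
proof -
  obtain inp s t out where c: "c = (inp, s, t, out)"
    by (cases c) auto
  define j where "j = Suc (length out)"
  note inv = DI_completes_invariant[OF assms(2)[unfolded c], folded j_def]
  note next_t = licensed_next_on_second_stack[OF assms(1) assms(2)[unfolded c], folded j_def]
  note next_s = licensed_next_on_first_stack[OF assms(1) assms(2)[unfolded c], folded j_def]
  have nxt: "next_output out = j"
    using DI_completes_next_output[OF assms(2)[unfolded c]] by (simp add: j_def)
  have ge: "x \<in> set inp \<union> set s \<union> set t \<Longrightarrow> j \<le> x" for x
    using inv by auto
  consider "j \<in> set t" | "j \<notin> set t" "j \<in> set s" | "j \<notin> set t" "j \<notin> set s"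
    by blast
  then show ?thesis
  proof cases
    case 1
    then have "t \<noteq> []" "hd t = j"
      using min_at_hd[of t j] inv ge by blast+
    with next_t[OF 1] c nxt show ?thesis by auto
  next
    case 2
    with next_s have s: "m = N" "s = [j]" by auto
    have "\<not> (t \<noteq> [] \<and> hd t = j)" using 2 by auto
    with s c nxt show ?thesis by auto
  next
    case 3
    \<comment> \<open>Any value \<open>v\<close> still in the machine shows that not everything has
      been output, so \<open>j\<close> is in the machine too.\<close>
    have in_inp: "j \<in> set inp" if "v \<in> set inp \<union> set s \<union> set t" for v
    proof -
      have "j \<in> set inp \<union> set s \<union> set t"
        using inv that by auto
      with 3 show ?thesis by blast
    qed
    note step = ADI_step_default[of out t s inp, unfolded nxt, OF 3, folded c]
    show ?thesis
    proof (cases m)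
      case E
      with assms(2) c obtain x inp' where x: "inp = x # inp'" "DI_completes n w (inp', x # s, t, out)"
        by auto
      have "s = [] \<or> hd s < x"
        using DI_completes_invariant[OF x(2)] by (cases s) auto
      moreover have "t = [] \<or> x < hd t"
      proof (rule ccontr)
        \<comment> \<open>Here the top \<open>z\<close> of the second stack blocks \<open>x\<close>,
          which \<open>E\<close> has just put on the first stack.\<close>
        assume "\<not> (t = [] \<or> x < hd t)"
        then obtain z t' where z: "t = z # t'" "z \<le> x" by (cases t) auto
        then have "z < x" "j < z"
          using DI_completes_invariant[OF x(2)] 3 ge[of z] z by (auto simp: le_less)
        moreover have "j \<in> set inp'"
          using in_inp[of z] x(1) z(1) \<open>z < x\<close> \<open>j < z\<close> by auto
        ultimately show False
          using no_input_behind_blocked[OF x(2), of z x j] z(1) by auto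
      qed
      ultimately show ?thesis using step x(1) E by auto
    next
      case N
      with assms(2) c obtain y s' where y: "s = y # s'" "DI_completes n w (inp, s', y # t, out)"
        by auto
      have "\<not> (inp \<noteq> [] \<and> hd s < hd inp)"
      proof
        \<comment> \<open>Here \<open>y\<close>, just moved by \<open>N\<close>, is the blocking
          value, and \<open>x\<close> is the next input entry.\<close>
        assume "inp \<noteq> [] \<and> hd s < hd inp"
        then obtain x inp' where x: "inp = x # inp'" "y < x"
          using y(1) by (cases inp) auto
        have "j < y" using y(1) 3 ge[of y] by (auto simp: le_less)
        moreover have "j \<in> set inp"
          using in_inp[of y] y(1) by simp
        ultimately show False
          using no_input_behind_blocked[OF y(2), of y x j] x by auto
      qed
      then show ?thesis using step y(1) N by auto
    next
      case C
      with assms(2) have "\<exists>t'. t = j # t'"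
        unfolding c C DI_completes_C j_def by blast
      with 3 show ?thesis
        by force
    qed
  qed
qed

lemma ADI_from_step:
  assumes "ADI_step c = [m]"
  shows "ADI_from c = (case exec m c of None \<Rightarrow> [] | Some c' \<Rightarrow> m # ADI_from c')"
proof -
  have "run [m] c = exec m c"
    by (cases "exec m c") simp_all
  then show ?thesis
    unfolding ADI_from.simps[of c] assms by (simp only: append_Cons append_Nil)
qed

lemma ADI_from_final: "ADI_from ([], [], [], out) = []"
  by (subst ADI_from.simps) simp

lemma ADI_from_licensed:
  assumes "licensed u w" "DI_completes n w c"
  shows "ADI_from c = w"
  using assms
proof (induction w arbitrary: u c)
  case Nil
  then show ?case by (simp add: ADI_from_final)
next
  case (Cons m w)
  from Cons.prems(2) obtain c' where c': "exec m c = Some c'" "DI_completes n w c'"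
    by (cases c) (auto simp: DI_completes.simps(2))
  have "ADI_from c' = w"
    using Cons.IH[OF _ c'(2)] Cons.prems(1) licensed_Cons by blast
  then show ?case
    using ADI_from_step[OF licensed_first_letter[OF Cons.prems]] c'(1) by simp
qed

section \<open>The algorithm produces licensed words\<close>

text \<open>The last two premises are the invariant of the induction; they hold vacuously when both
  stacks are empty.\<close>

lemma licensed_ADI_from:
  assumes "DI_completes n w (inp, s, t, out)" "ADI_from (inp, s, t, out) = w"
    and "Suc (length out) \<in> set s \<Longrightarrow> s = [Suc (length out)] \<and> suffix [E] u"
    and "Suc (length out) \<in> set t \<Longrightarrow> s = [] \<and> (suffix [C] u \<or> suffix [E, N] u)"
  shows "licensed u w"
  using assms
proof (induction w arbitrary: u inp s t out)
  case (Cons m w)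
  let ?c = "(inp, s, t, out)"
  define j where "j = Suc (length out)"
  note on_s = Cons.prems(3)[folded j_def] and on_t = Cons.prems(4)[folded j_def]
  note inv = DI_completes_invariant[OF Cons.prems(1), folded j_def]
  obtain c' where c': "exec m ?c = Some c'" "DI_completes n w c'"
    using Cons.prems(1) unfolding DI_completes.simps(2) by blast
  have nxt: "next_output out = j"
    using DI_completes_next_output[OF Cons.prems(1)] by (simp add: j_def)
  have ge: "x \<in> set inp \<union> set s \<union> set t \<Longrightarrow> j \<le> x" for x
    using inv by auto
  have step: "m = m' \<and> ADI_from c' = w" if "ADI_step ?c = [m']" for m'
    using ADI_from_step[OF that] Cons.prems(2) c'(1) by (auto split: option.splits)
  consider "j \<in> set t" | "j \<notin> set t" "j \<in> set s" | "j \<notin> set t" "j \<notin> set s"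
    by blast
  then show ?case
  proof cases
    case 1
    then have "t \<noteq> []" "hd t = j"
      using min_at_hd[of t j] inv ge by blast+
    then have st: "ADI_step ?c = [C]" using nxt by simp
    note m = conjunct1[OF step[OF st]]
    obtain t' where t': "c' = (inp, s, t', out @ [j])"
      using c'(1) m \<open>hd t = j\<close> by auto
    \<comment> \<open>The first stack is empty, and the new \<open>C\<close> licenses a
      \<open>C\<close> that may follow.\<close>
    have "licensed (u @ [C]) w"
      by (rule Cons.IH[OF c'(2)[unfolded t'] conjunct2[OF step[OF st], unfolded t']])
        (use on_t[OF 1] in \<open>auto simp: suffix_def\<close>)
    with on_t[OF 1] m show ?thesis by (simp add: licensed_Cons)
  next
    case 2
    with on_s have s: "s = [j]" "suffix [E] u" by auto
    have "\<not> (t \<noteq> [] \<and> hd t = j)" using 2 by auto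
    then have st: "ADI_step ?c = [N]" using nxt s(1) by auto
    note m = conjunct1[OF step[OF st]]
    have c'_eq: "c' = (inp, [], j # t, out)"
      using c'(1) m s by auto
    \<comment> \<open>Together with the \<open>E\<close> ending \<open>u\<close>, this
      \<open>N\<close> licenses the output of \<open>j\<close>.\<close>
    have "licensed (u @ [N]) w"
      by (rule Cons.IH[OF c'(2)[unfolded c'_eq] conjunct2[OF step[OF st], unfolded c'_eq]])
        (use s(2) in \<open>auto simp: suffix_def\<close>)
    with m show ?thesis by (simp add: licensed_Cons)
  next
    case 3
    consider (e) "ADI_step ?c = [E]" | (n) "ADI_step ?c = [N]"
      using ADI_step_default[of out t s inp, unfolded nxt, OF 3] by metis
    then show ?thesis
    proof cases
      case e
      note m = conjunct1[OF step[OF e]]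
      obtain x inp' where x: "inp = x # inp'" "c' = (inp', x # s, t, out)"
        using c'(1) m by auto
      have "licensed (u @ [E]) w"
      proof (rule Cons.IH[OF c'(2)[unfolded x] conjunct2[OF step[OF e], unfolded x]], fold j_def)
        \<comment> \<open>Only the entry just read can be \<open>j\<close>, and below it only
          smaller values could lie.\<close>
        assume "j \<in> set (x # s)"
        with 3 have "x = j" by auto
        then have "s = []"
          using c'(2) x bottom_next_unique unfolding j_def by blast
        with \<open>x = j\<close> show "x # s = [j] \<and> suffix [E] (u @ [E])"
          by (auto simp: suffix_def)
      qed (use 3 in auto)
      with m show ?thesis by (simp add: licensed_Cons)
    next
      case n
      note m = conjunct1[OF step[OF n]]
      obtain y s' where y: "s = y # s'" "c' = (inp, s', y # t, out)"
        using c'(1) m by auto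
      \<comment> \<open>Since \<open>j\<close> was on neither stack, it still is on neither, and the
        invariant is vacuous.\<close>
      have "licensed (u @ [N]) w"
        by (rule Cons.IH[OF c'(2)[unfolded y] conjunct2[OF step[OF n], unfolded y]], fold j_def)
          (use 3 y in auto)
      with m show ?thesis by (simp add: licensed_Cons)
    qed
  qed
qed simp

section \<open>From DI words to successful runs\<close>

lemma exec_mset:
  "exec m (inp, s, t, out) = Some (inp', s', t', out') \<Longrightarrow>
     mset inp' + mset s' + mset t' + mset out' = mset inp + mset s + mset t + mset out"
  by (cases m) auto

text \<open>Moves preserve the total multiset of values, so once \<open>[1..<Suc n]\<close> has been
  output the input and both stacks are empty.\<close>

lemma DI_completesI:
  assumes "run w (inp, s, t, out) = Some (inp', s', t', [1..<Suc n])"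
    and "\<forall>k\<le>length w. \<forall>inp' s' t' out'.
      run (take k w) (inp, s, t, out) = Some (inp', s', t', out') \<longrightarrow>
      sorted_wrt (>) s' \<and> sorted_wrt (<) t'"
    and "mset inp + mset s + mset t + mset out = mset [1..<Suc n]"
  shows "DI_completes n w (inp, s, t, out)"
  using assms
proof (induction w arbitrary: inp s t out)
  case Nil
  then show ?case by auto
next
  case (Cons m w)
  then obtain inp1 s1 t1 out1 where c1: "exec m (inp, s, t, out) = Some (inp1, s1, t1, out1)"
    "run w (inp1, s1, t1, out1) = Some (inp', s', t', [1..<Suc n])"
    by (auto simp: bind_eq_Some_conv)
  have "DI_completes n w (inp1, s1, t1, out1)"
  proof (rule Cons.IH[OF c1(2)])
    show "\<forall>k\<le>length w. \<forall>inp' s' t' out'.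
        run (take k w) (inp1, s1, t1, out1) = Some (inp', s', t', out') \<longrightarrow>
        sorted_wrt (>) s' \<and> sorted_wrt (<) t'"
    proof (intro allI impI)
      fix k inp' s' t' out'
      assume "k \<le> length w" "run (take k w) (inp1, s1, t1, out1) = Some (inp', s', t', out')"
      then show "sorted_wrt (>) s' \<and> sorted_wrt (<) t'"
        using Cons.prems(2)[rule_format, of "Suc k" inp' s' t' out'] c1(1) by simp
    qed
    show "mset inp1 + mset s1 + mset t1 + mset out1 = mset [1..<Suc n]"
      using exec_mset[OF c1(1)] Cons.prems(3) by simp
  qed
  then show ?case
    using c1(1) Cons.prems(2)[rule_format, of 0] by (auto simp: DI_completes.simps(2))
qed

section \<open>Licences expressed by labels\<close>

lemma run_append: "run (u @ v) c = Option.bind (run u c) (run v)"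
proof (induction u arbitrary: c)
  case (Cons m u)
  then show ?case by (cases "exec m c") simp_all
qed simp

lemma label_from_append:
  "run u c = Some c' \<Longrightarrow> label_from (u @ v) c = label_from u c @ label_from v c'"
  by (induction u arbitrary: c) (auto simp: bind_eq_Some_conv)

lemma label_from_ENC:
  assumes "run (E # N # C # v) c \<noteq> None"
  shows "\<exists>x ls. label_from (E # N # C # v) c = (E, x) # (N, x) # (C, x) # ls"
proof -
  obtain inp s t out where c: "c = (inp, s, t, out)"
    by (cases c)
  with assms show ?thesis
    by (cases inp) auto
qed

lemma map_fst_label_from: "run w c = Some c' \<Longrightarrow> map fst (label_from w c) = w"
  by (induction w arbitrary: c) (auto simp: bind_eq_Some_conv)

text \<open>For a sorting word this makes the labels of the letters \<open>C\<close> run through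
  \<open>1\<close>, ..., \<open>n\<close> in order, each once.\<close>

lemma outputs_label_from:
  assumes "run w (inp, s, t, out) = Some (inp', s', t', out')"
  shows "out' = out @ map snd (filter (\<lambda>l. fst l = C) (label_from w (inp, s, t, out)))"
  using assms
proof (induction w arbitrary: inp s t out)
  case (Cons m w)
  then show ?case by (cases m) (fastforce simp: bind_eq_Some_conv)+
qed simp

lemma unique_label_decomposition:
  assumes "distinct (map snd (filter (\<lambda>l. fst l = C) L))"
    and "L = a @ (C, x) # b" "L = a' @ (C, x) # b'"
  shows "a = a'"
proof -
  from assms(1,2) have "(C, x) \<notin> set a" "(C, x) \<notin> set b"
    by (force simp: image_iff)+
  with assms(2,3) show ?thesis
    by (metis append_Cons_eq_iff)
qed

text \<open>Adjacent letters \<open>C\<close> output consecutive values, and in \<open>E\<close>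
  \<open>N\<close> \<open>C\<close> a single value passes through both stacks, so the letters
  determine the labels. Conversely \<open>(C, x)\<close> occurs only once, so the labelled pattern
  ends at the \<open>C\<close> in question.\<close>

lemma licensed_iff_labels:
  assumes run_W: "run W (initial \<pi>) = Some (inp, s, t, [1..<Suc n])"
  shows "licensed [] W \<longleftrightarrow>
    (\<forall>x\<in>{1..n}.
       x \<noteq> 1 \<and> sublist [(C, x - 1), (C, x)] (labelled_word \<pi> W) \<or>
       sublist [(E, x), (N, x), (C, x)] (labelled_word \<pi> W))"
proof -
  define L where "L = labelled_word \<pi> W"
  let ?out = "\<lambda>L :: (move \<times> nat) list. map snd (filter (\<lambda>l. fst l = C) L)"
  have out_L: "?out L = [1..<Suc n]"
    using outputs_label_from[of W \<pi> "[]" "[]" "[]"] run_W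
    by (simp add: initial_def L_def labelled_word_def)
  have fst_L: "map fst L = W"
    using map_fst_label_from[OF run_W] by (simp add: L_def labelled_word_def)
  have dist: "distinct (?out L)"
    by (simp add: out_L)
  have preceding: "x \<noteq> 1 \<and> sublist [(C, x - 1), (C, x)] L \<or> sublist [(E, x), (N, x), (C, x)] L"
    if lic: "licensed [] W" and x: "x \<in> {1..n}" for x
  proof -
    have "x \<in> set (?out L)" using x out_L by auto
    then have "(C, x) \<in> set L" by auto
    then obtain a b where L: "L = a @ (C, x) # b" by (meson split_list)
    then have "W = map fst a @ C # map fst b" using fst_L by auto
    with lic consider "suffix [C] (map fst a)" | "suffix [E, N] (map fst a)"
      unfolding licensed_def by auto
    then show ?thesis
    proof cases
      case 1
      then obtain a' y where a: "a = a' @ [(C, y)]"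
        by (auto simp: suffix_def map_eq_append_conv)
      define b' where "b' = ?out b"
      have out: "?out a' @ y # x # b' = [1..<Suc n]"
        using out_L L a by (simp add: b'_def)
      \<comment> \<open>Exactly \<open>i\<close> values are output before \<open>y\<close>, so
        \<open>y\<close> and \<open>x\<close> are \<open>i + 1\<close> and \<open>i + 2\<close>;
        this also gives \<open>x \<noteq> 1\<close>.\<close>
      define i where "i = length (?out a')"
      have "i + 1 < n"
        using arg_cong[OF out, of length] by (simp add: i_def del: upt_Suc)
      moreover have "y = [1..<Suc n] ! i" "x = [1..<Suc n] ! Suc i"
        unfolding out[symmetric] by (simp_all add: i_def nth_append)
      ultimately have "y = Suc i" "x = Suc (Suc i)"
        by (auto simp del: upt_Suc)
      with L a show ?thesis
        by (auto simp: sublist_def)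
    next
      case 2
      then obtain a' y z where a: "a = a' @ [(E, y), (N, z)]"
        by (auto simp: suffix_def map_eq_append_conv)
      let ?v = "E # N # C # map fst b"
      have "W = map fst a' @ ?v"
        using fst_L L a by auto
      with run_W obtain c where c: "run (map fst a') (initial \<pi>) = Some c" "run ?v c \<noteq> None"
        by (auto simp: run_append bind_eq_Some_conv simp del: run.simps)
      obtain w ws where ws: "label_from ?v c = (E, w) # (N, w) # (C, w) # ws"
        using label_from_ENC[OF c(2)] by blast
      have "L = label_from (map fst a') (initial \<pi>) @ (E, w) # (N, w) # (C, w) # ws"
        unfolding L_def labelled_word_def \<open>W = map fst a' @ ?v\<close>
        using label_from_append[OF c(1)] ws by simp
      moreover have "L = a' @ (E, y) # (N, z) # (C, x) # b"
        using L a by simp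
      \<comment> \<open>With prefixes of equal length the two decompositions of \<open>L\<close> can
        be compared label by label.\<close>
      moreover have "length (label_from (map fst a') (initial \<pi>)) = length a'"
        using map_fst_label_from[OF c(1)] by (metis length_map)
      ultimately have "y = x" "z = x"
        by auto
      with L a show ?thesis
        by (auto simp: sublist_def)
    qed
  qed
  have "licensed [] W"
    if labels: "\<forall>x\<in>{1..n}. x \<noteq> 1 \<and> sublist [(C, x - 1), (C, x)] L \<or>
      sublist [(E, x), (N, x), (C, x)] L"
    unfolding licensed_def
  proof (intro allI impI)
    fix p q
    assume "W = p @ C # q"
    then obtain a x b where L: "L = a @ (C, x) # b" and p: "p = map fst a"
      using fst_L by (auto simp: map_eq_append_conv)
    have "x \<in> set (?out L)" using L by simp
    then have "x \<in> {1..n}" using out_L by auto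
    with labels consider "sublist [(C, x - 1), (C, x)] L" | "sublist [(E, x), (N, x), (C, x)] L"
      by blast
    then show "suffix [C] ([] @ p) \<or> suffix [E, N] ([] @ p)"
    proof cases
      case 1
      then obtain a' b' where "L = (a' @ [(C, x - 1)]) @ (C, x) # b'"
        by (auto simp: sublist_def)
      then have "a = a' @ [(C, x - 1)]"
        using unique_label_decomposition[OF dist L] by blast
      then show ?thesis using p by (simp add: suffix_def)
    next
      case 2
      then obtain a' b' where "L = (a' @ [(E, x), (N, x)]) @ (C, x) # b'"
        by (auto simp: sublist_def)
      then have "a = a' @ [(E, x), (N, x)]"
        using unique_label_decomposition[OF dist L] by blast
      then show ?thesis using p by (simp add: suffix_def)
    qed
  qed
  with preceding show ?thesis
    unfolding L_def by blast
qed

theorem theorem2p12: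
  fixes n :: nat and \<pi> :: "nat list" and W :: "move list"
  assumes "n \<ge> 1"
    and "\<pi> \<in> permutations_of_set {1..n}"
    and "DI_sortable \<pi>"
    and "DI_word \<pi> W"
  shows "(W = ADI_word \<pi> \<longleftrightarrow>
            sublist [(E, 1), (N, 1), (C, 1)] (labelled_word \<pi> W) \<and>
            (\<forall>i<n. \<pi> ! i \<noteq> 1 \<longrightarrow>
               sublist [(C, \<pi> ! i - 1), (C, \<pi> ! i)] (labelled_word \<pi> W) \<or>
               sublist [(E, \<pi> ! i), (N, \<pi> ! i), (C, \<pi> ! i)] (labelled_word \<pi> W)))
       \<and> (W = ADI_word \<pi> \<longleftrightarrow>
            (\<forall>u k v. maximal_C_block W u k v \<longrightarrow> suffix [E, N] u))"
proof -
  have perm: "set \<pi> = {1..n}" "distinct \<pi>"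
    using assms(2) by (auto simp: permutations_of_set_def)
  then have len: "length \<pi> = n"
    using distinct_card by fastforce
  obtain inp s t where run_W: "run W (initial \<pi>) = Some (inp, s, t, [1..<Suc n])"
    using assms(4) len by (auto simp: DI_word_def sorting_word_def)
  have "mset \<pi> = mset [1..<Suc n]"
    using perm set_eq_iff_mset_eq_distinct[of \<pi> "[1..<Suc n]"]
    by (simp add: atLeastLessThanSuc_atLeastAtMost del: upt_Suc)
  then have compl: "DI_completes n W (\<pi>, [], [], [])"
    using DI_completesI[of W \<pi> "[]" "[]" "[]" inp s t n] run_W assms(4)
    by (simp add: initial_def DI_word_def)
  have ADI: "W = ADI_word \<pi> \<longleftrightarrow> licensed [] W"
    unfolding ADI_word_def initial_def
    using ADI_from_licensed[OF _ compl] licensed_ADI_from[OF compl, of "[]"] by auto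
  \<comment> \<open>Vacuous at \<open>1\<close>, whose condition is the separate conjunct on
    \<open>E\<close>, \<open>N\<close>, \<open>C\<close> moving \<open>1\<close>. The rule is stated
    for values, to pass between positions of \<open>\<pi>\<close> and elements of
    \<open>{1..n}\<close>.\<close>
  define labelled_rule where "labelled_rule x \<longleftrightarrow>
      (x \<noteq> 1 \<longrightarrow> sublist [(C, x - 1), (C, x)] (labelled_word \<pi> W) \<or>
        sublist [(E, x), (N, x), (C, x)] (labelled_word \<pi> W))" for x
  have "(\<forall>i<n. labelled_rule (\<pi> ! i)) \<longleftrightarrow> (\<forall>x\<in>{1..n}. labelled_rule x)"
    using perm(1) len by (metis in_set_conv_nth)
  then have "licensed [] W \<longleftrightarrow>
      sublist [(E, 1), (N, 1), (C, 1)] (labelled_word \<pi> W) \<and> (\<forall>i<n. labelled_rule (\<pi> ! i))"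
    unfolding licensed_iff_labels[OF run_W] using assms(1) by (auto simp: labelled_rule_def)
  with ADI licensed_iff_maximal_C_block[of W] show ?thesis
    unfolding labelled_rule_def by blast
qed

end
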